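(* Let $q=p^k$, where $p$ is prime, let $r\ge 2$ and $n\ge 1$ be integers, and let $A_1,\ldots,A_{r-1}\in \operatorname{GL}_n(\mathbb{F}_q)$. If $k\ge r$, then there is an $x\in\mathbb{F}_q^n$ such that the vectors $x, A_1x,\ldots,A_{r-1}x$ are all nowhere zero.
   Context: A vector in $\mathbb{F}_q^n$ is called nowhere zero if none of its coordinates is zero. $\mathbb{F}_q$ is the finite field with $q$ elements. *)

theory Defs
  imports "HOL-Analysis.Analysis" "HOL-Computational_Algebra.Primes"
begin

definition nowhere_zero :: "'a::zero ^ 'n \<Rightarrow> bool" where
  "nowhere_zero v \<longleftrightarrow> (\<forall>j. v $ j \<noteq> 0)"

end

theory Submission
  imports Defs "HOL-Number_Theory.Residues"
begin

text \<open>
  Let \<open>q = p ^ k\<close> and pad the given matrices with identities to invertible \<open>B\<^sub>0, \<dots>, B\<^sub>k\<^sub>-\<^sub>1\<close>. It suffices that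
  the sum over all \<open>x\<close> of the product of \<open>((B\<^sub>j x)\<^sub>i) ^ (p ^ j * (p - 1))\<close> over all \<open>i, j\<close> is nonzero.
  Each \<open>((B\<^sub>j x)\<^sub>i) ^ p ^ j\<close> is additive in \<open>x\<close>, so with respect to \<open>\<int>/p\<close>-coordinates the summand is a
  polynomial of degree \<open>k n (p - 1)\<close>, which is the least degree for which the sum over the
  \<open>k n\<close>-dimensional space need not vanish. Multiplying \<open>B\<^sub>j\<close> by a matrix multiplies the sum by a
  constant: in a product of \<open>n (p - 1)\<close> linear combinations of additive maps \<open>a\<^sub>1, \<dots>, a\<^sub>n\<close>, every
  monomial other than \<open>(a\<^sub>1 \<dots> a\<^sub>n) ^ (p - 1)\<close> contains some \<open>a\<^sub>l ^ p\<close>, which is again additive, and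
  so has smaller degree. Using the inverse of \<open>B\<^sub>j\<close>, one can replace each \<open>B\<^sub>j\<close> by the identity
  without affecting whether the sum vanishes. For identity matrices the summand is the indicator
  of the nowhere zero vectors, of which there are \<open>(q - 1) ^ n \<equiv> (-1) ^ n\<close>.
\<close>

section \<open>Finite differences and the degree they define\<close>

definition diff :: "'g::ab_group_add \<Rightarrow> ('g \<Rightarrow> 'b::comm_ring_1) \<Rightarrow> 'g \<Rightarrow> 'b" where
  "diff e f x = f (x + e) - f x"

text \<open>Degree is measured by iterated differences, so that Frobenius powers of linear forms have degree 1.\<close>

primrec deg_le :: "nat \<Rightarrow> ('g::ab_group_add \<Rightarrow> 'b::comm_ring_1) \<Rightarrow> bool" where
  "deg_le 0 f \<longleftrightarrow> (\<forall>e. diff e f = (\<lambda>_. 0))"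
| "deg_le (Suc d) f \<longleftrightarrow> (\<forall>e. deg_le d (diff e f))"

lemma diff_const [simp]: "diff e (\<lambda>_. c) = (\<lambda>_. 0)"
  by (simp add: diff_def fun_eq_iff)

lemma diff_add: "diff e (\<lambda>x. f x + g x) = (\<lambda>x. diff e f x + diff e g x)"
  by (simp add: diff_def fun_eq_iff)

lemma diff_shift: "diff e (\<lambda>x. f (x + v)) = (\<lambda>x. diff e f (x + v))"
  by (simp add: diff_def fun_eq_iff ac_simps)

lemma diff_mult: "diff e (\<lambda>x. f x * g x) = (\<lambda>x. diff e f x * g (x + e) + f x * diff e g x)"
  by (simp add: diff_def fun_eq_iff algebra_simps)

lemma funpow_diff_zero [simp]: "(diff e ^^ s) (\<lambda>_. 0) = (\<lambda>_. 0)"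
  by (induction s) simp_all

lemma deg_le_const [simp]: "deg_le d (\<lambda>_. c)"
  by (induction d arbitrary: c) simp_all

lemma deg_le_Suc: "deg_le d f \<Longrightarrow> deg_le (Suc d) f"
  by (induction d arbitrary: f) (simp, simp only: deg_le.simps, blast)

lemma deg_le_mono: "deg_le d f \<Longrightarrow> d \<le> d' \<Longrightarrow> deg_le d' f"
  by (rotate_tac 1, induction rule: dec_induct) (auto simp del: deg_le.simps intro: deg_le_Suc)

lemma deg_le_add: "deg_le d f \<Longrightarrow> deg_le d g \<Longrightarrow> deg_le d (\<lambda>x. f x + g x)"
  by (induction d arbitrary: f g) (simp_all add: diff_add)

lemma deg_le_shift: "deg_le d f \<Longrightarrow> deg_le d (\<lambda>x. f (x + v))"
  by (induction d arbitrary: f) (simp_all add: diff_shift)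

text \<open>By the product rule for differences, each summand of the difference of
  \<open>f * g\<close> differences only one factor, so \<open>a + b\<close> drops by one. If the
  degree of that factor is already 0, the summand vanishes.\<close>

lemma deg_le_mult:
  "deg_le a f \<Longrightarrow> deg_le b g \<Longrightarrow> deg_le (a + b) (\<lambda>x. f x * g x)"
proof (induction "a + b" arbitrary: a b f g)
  case 0
  then show ?case by (simp add: diff_mult)
next
  case (Suc n)
  have "deg_le n (\<lambda>x. diff e f x * g (x + e))" for e
  proof (cases a)
    case 0
    with Suc.prems show ?thesis by simp
  next
    case (Suc a')
    with Suc.hyps Suc.prems deg_le_shift[of b g e] show ?thesis by simp
  qed
  moreover have "deg_le n (\<lambda>x. f x * diff e g x)" for e
  proof (cases b)
    case 0
    with Suc.prems show ?thesis by simp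
  next
    case (Suc b')
    with Suc.hyps Suc.prems show ?thesis by simp
  qed
  ultimately show ?case
    by (simp add: Suc.hyps(2)[symmetric] diff_mult deg_le_add)
qed

lemma deg_le_prod:
  "(\<And>i. i \<in> I \<Longrightarrow> deg_le (d i) (f i)) \<Longrightarrow> deg_le (sum d I) (\<lambda>x. \<Prod>i\<in>I. f i x)"
  by (induction I rule: infinite_finite_induct) (simp_all add: deg_le_mult)

lemma deg_le_power: "deg_le d f \<Longrightarrow> deg_le (m * d) (\<lambda>x. f x ^ m)"
  by (induction m) (simp_all add: deg_le_mult)

lemma deg_le_additive:
  assumes "Modules.additive f"
  shows "deg_le 1 f"
proof -
  have "diff e f = (\<lambda>_. f e)" for e
    by (simp add: diff_def Modules.additive.add[OF assms] fun_eq_iff)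
  then show ?thesis by simp
qed

lemma deg_le_funpow_diff:
  "deg_le d f \<Longrightarrow> s \<le> d \<Longrightarrow> deg_le (d - s) ((diff e ^^ s) f)"
proof (induction s arbitrary: f d)
  case (Suc s)
  then obtain d' where "d = Suc d'" "s \<le> d'" by (cases d) auto
  with Suc show ?case by (simp add: funpow_Suc_right del: funpow.simps)
qed simp

lemma funpow_diff_eq_0:
  "deg_le d f \<Longrightarrow> d < s \<Longrightarrow> (diff e ^^ s) f = (\<lambda>_. 0)"
proof (induction d arbitrary: f s)
  case 0
  then obtain s' where "s = Suc s'" by (cases s) auto
  with 0 show ?case by (simp add: funpow_Suc_right del: funpow.simps)
next
  case (Suc d)
  then obtain s' where "s = Suc s'" by (cases s) auto
  with Suc show ?case by (simp add: funpow_Suc_right del: funpow.simps)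
qed

section \<open>Sums along lines in characteristic p\<close>

text \<open>Translation by \<open>e\<close> is the operator T = 1 + D with D =
  \<open>diff e\<close>, and 1 + T + ... + T^(m-1) = ((1 + D)^m - 1) / D. The induction on
  \<open>m\<close> is Pascal's rule.\<close>

lemma sum_translates:
  fixes f :: "'a::field ^ 'n \<Rightarrow> 'a"
  shows "(\<Sum>t<m. f (y + of_nat t *s e)) = (\<Sum>s<m. of_nat (m choose Suc s) * (diff e ^^ s) f y)"
proof (induction m arbitrary: f)
  case 0
  then show ?case by simp
next
  case (Suc m)
  have "(\<Sum>t<Suc m. f (y + of_nat t *s e)) = f y + (\<Sum>t<m. f (y + of_nat t *s e + e))"
    by (subst sum.lessThan_Suc_shift) (simp add: algebra_simps vector_sadd_rdistrib)
  also have "(\<Sum>t<m. f (y + of_nat t *s e + e)) =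
      (\<Sum>t<m. f (y + of_nat t *s e)) + (\<Sum>t<m. diff e f (y + of_nat t *s e))"
    by (simp add: diff_def flip: sum.distrib)
  also have "\<dots> = (\<Sum>s<m. of_nat (m choose Suc s) * (diff e ^^ s) f y)
      + (\<Sum>s<m. of_nat (m choose Suc s) * (diff e ^^ Suc s) f y)"
    by (simp add: Suc.IH funpow_Suc_right del: funpow.simps)
  finally have "(\<Sum>t<Suc m. f (y + of_nat t *s e)) = f y
      + (\<Sum>s<m. of_nat (m choose Suc s) * (diff e ^^ s) f y)
      + (\<Sum>s<m. of_nat (m choose Suc s) * (diff e ^^ Suc s) f y)"
    by simp
  moreover have "(\<Sum>s<Suc m. of_nat (Suc m choose Suc s) * (diff e ^^ s) f y) =
     (\<Sum>s<Suc m. of_nat (m choose s) * (diff e ^^ s) f y) +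
     (\<Sum>s<Suc m. of_nat (m choose Suc s) * (diff e ^^ s) f y)"
    by (simp add: algebra_simps flip: sum.distrib)
  moreover have "(\<Sum>s<Suc m. of_nat (m choose s) * (diff e ^^ s) f y) =
     f y + (\<Sum>s<m. of_nat (m choose Suc s) * (diff e ^^ Suc s) f y)"
    by (subst sum.lessThan_Suc_shift) simp
  moreover have "(\<Sum>s<Suc m. of_nat (m choose Suc s) * (diff e ^^ s) f y) =
     (\<Sum>s<m. of_nat (m choose Suc s) * (diff e ^^ s) f y)"
    by (simp add: binomial_eq_0)
  ultimately show ?case by (simp only: ac_simps)
qed

text \<open>For \<open>m = p\<close> every binomial coefficient except the last is divisible by
  \<open>p\<close>. Summing over a full line thus lowers the degree by \<open>p - 1\<close>.\<close>

lemma sum_line: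
  fixes f :: "'a::field ^ 'n \<Rightarrow> 'a"
  assumes "prime p" and "CHAR('a) = p"
  shows "(\<Sum>t<p. f (y + of_nat t *s e)) = (diff e ^^ (p - 1)) f y"
proof -
  obtain m where m: "p = Suc m" using prime_gt_0_nat[OF assms(1)] by (cases p) auto
  have "of_nat (p choose Suc s) = (0::'a)" if "s < m" for s
    unfolding of_nat_eq_0_iff_char_dvd assms(2)
    by (rule dvd_choose_prime) (use that m assms(1) in auto)
  then have "(\<Sum>s<p. of_nat (p choose Suc s) * (diff e ^^ s) f y) = (diff e ^^ m) f y"
    by (simp add: m binomial_eq_0)
  then show ?thesis by (simp add: sum_translates m)
qed

section \<open>Finite fields and counting vectors\<close>

lemma CHAR_finite_field:
  assumes "prime p" and "CARD('a::{field,finite}) = p ^ k"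
  shows "CHAR('a) = p"
proof -
  have "prime CHAR('a)"
    using finite_imp_CHAR_pos[where ?'a = 'a] prime_CHAR_semidom[where ?'a = 'a] by simp
  moreover have "CHAR('a) dvd p ^ k" using CHAR_dvd_CARD[where ?'a = 'a] assms(2) by simp
  ultimately show ?thesis
    using assms(1) prime_dvd_power primes_dvd_imp_eq by blast
qed

lemma field_power_card_minus_1:
  fixes x :: "'a::{field,finite}"
  assumes "x \<noteq> 0"
  shows "x ^ (CARD('a) - 1) = 1"
proof -
  have "(\<Prod>y\<in>-{0}. x * y) = \<Prod>(-{0::'a})"
    by (rule prod.reindex_bij_witness[of _ "\<lambda>y. y / x" "\<lambda>y. x * y"]) (use assms in auto)
  then have "x ^ card (-{0::'a}) * \<Prod>(-{0::'a}) = \<Prod>(-{0::'a})"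
    by (simp add: prod.distrib)
  then show ?thesis by (simp add: Compl_eq_Diff_UNIV)
qed

lemma card_vec_range:
  "card {x :: 'a::finite ^ 'n. \<forall>i. x $ i \<in> S} = card S ^ CARD('n)"
proof -
  have "bij_betw vec_nth {x :: 'a ^ 'n. \<forall>i. x $ i \<in> S} (PiE UNIV (\<lambda>_. S))"
    by (intro bij_betwI[of _ _ _ vec_lambda]) (auto simp: vec_eq_iff)
  then show ?thesis by (simp add: bij_betw_same_card card_PiE)
qed


section \<open>Vanishing of sums of functions of low degree\<close>

text \<open>\<open>K\<close> acts as a subspace over the prime field, and the image of
  \<open>g\<close> is its direct sum with the line spanned by \<open>e\<close>. Growing subgroups in
  this way replaces a choice of coordinates.\<close>

lemma subgroup_extend:
  fixes K :: "('a::{field,finite} ^ 'n) set"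
  assumes p: "prime p" "CHAR('a) = p"
    and K: "0 \<in> K" "\<And>x y. x \<in> K \<Longrightarrow> y \<in> K \<Longrightarrow> x + y \<in> K"
    and e: "e \<notin> K"
  defines "g \<equiv> \<lambda>(y, t). y + of_nat t *s e"
  shows "inj_on g (K \<times> {..<p})"
    and "0 \<in> g ` (K \<times> {..<p})"
    and "x \<in> g ` (K \<times> {..<p}) \<Longrightarrow> y \<in> g ` (K \<times> {..<p}) \<Longrightarrow> x + y \<in> g ` (K \<times> {..<p})"
proof -
  have mult: "of_nat c *s y \<in> K" if "y \<in> K" for c y
    using that by (induction c) (simp_all add: K vector_sadd_rdistrib)
  have p0: "of_nat p = (0::'a)" using p(2) of_nat_CHAR by blast
  have diff_mem: "y - z \<in> K" if "y \<in> K" "z \<in> K" for y z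
  proof -
    \<comment> \<open>Negation is multiplication by \<open>p - 1\<close>, so closure under addition
      gives closure under differences.\<close>
    have "of_nat (p - 1) = (- 1 :: 'a)" using p0 prime_gt_0_nat[OF p(1)] by (simp add: of_nat_diff)
    then have "y - z = y + of_nat (p - 1) *s z" by simp
    then show ?thesis using that K mult by metis
  qed
  have neq: False if "y \<in> K" "z \<in> K" "s < t" "t < p" "y + of_nat s *s e = z + of_nat t *s e" for y z s t
  proof -
    have "of_nat (t - s) *s e = y - z"
      using that by (simp add: of_nat_diff vector_ssub_ldistrib algebra_simps vec.scale_left_diff_distrib)
    then have mem: "of_nat (t - s) *s e \<in> K" using diff_mem that by metis
    \<comment> \<open>As \<open>t - s\<close> is invertible modulo \<open>p\<close>, a multiple of
      the element just placed in \<open>K\<close> is \<open>e\<close> itself.\<close>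
    have "coprime (t - s) p"
      using that p(1) by (metis coprime_commute diff_is_0_eq' dvd_imp_le less_imp_diff_less linorder_not_less nat_less_le prime_imp_coprime zero_less_diff)
    then obtain c where "[(t - s) * c = 1] (mod p)" using cong_solve_coprime_nat by auto
    then have "of_nat ((t - s) * c) = (of_nat 1 :: 'a)"
      unfolding of_nat_eq_iff_cong_CHAR p(2) .
    then have "of_nat c *s (of_nat (t - s) *s e) = e"
      by (metis mult.commute of_nat_1 of_nat_mult vector_smult_assoc vec.scale_one)
    then show False using mult[OF mem] e by metis
  qed
  show "inj_on g (K \<times> {..<p})"
  proof (rule inj_onI)
    fix u v
    assume *: "u \<in> K \<times> {..<p}" "v \<in> K \<times> {..<p}" "g u = g v"
    obtain y s z t where uv: "u = (y, s)" "v = (z, t)" by (cases u, cases v)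
    with * have eq: "y + of_nat s *s e = z + of_nat t *s e" by (simp add: g_def)
    with * uv neq[of y z s t] neq[of z y t s] have "s = t"
      by (cases s t rule: linorder_cases) auto
    with eq uv show "u = v" by simp
  qed
  show "0 \<in> g ` (K \<times> {..<p})"
    by (rule image_eqI[of _ _ "(0, 0)"]) (use K prime_gt_0_nat[OF p(1)] in \<open>auto simp: g_def\<close>)
  assume "x \<in> g ` (K \<times> {..<p})" "y \<in> g ` (K \<times> {..<p})"
  then obtain u s v t where *: "u \<in> K" "v \<in> K" "x = u + of_nat s *s e" "y = v + of_nat t *s e"
    by (auto simp: g_def)
  have "of_nat ((s + t) mod p) = (of_nat (s + t) :: 'a)"
    unfolding of_nat_eq_iff_cong_CHAR p(2) by simp
  then have "x + y = g (u + v, (s + t) mod p)"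
    by (simp add: * g_def algebra_simps vector_sadd_rdistrib)
  then show "x + y \<in> g ` (K \<times> {..<p})"
    using * K prime_gt_0_nat[OF p(1)] by auto
qed

text \<open>Induction on \<open>N\<close>: summing first along the lines in the new direction
  \<open>e\<close> leaves a sum over the smaller subgroup of a function whose degree is lower by
  \<open>p - 1\<close>.\<close>

lemma exists_subgroup_sum_deg_le_eq_0:
  assumes p: "prime p" "CHAR('a::{field,finite}) = p" and "p ^ N \<le> CARD('a ^ 'n)"
  shows "\<exists>K :: ('a ^ 'n) set. 0 \<in> K \<and> (\<forall>x\<in>K. \<forall>y\<in>K. x + y \<in> K) \<and> card K = p ^ N \<and>
    (\<forall>(f :: 'a ^ 'n \<Rightarrow> 'a) d. deg_le d f \<longrightarrow> d < N * (p - 1) \<longrightarrow> sum f K = 0)"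
  using assms(3)
proof (induction N)
  case 0
  show ?case by (intro exI[of _ "{0}"]) auto
next
  case (Suc N)
  have p1: "p > 1" using p(1) prime_gt_1_nat by blast
  then have less: "p ^ N < p ^ Suc N" by simp
  then have "p ^ N \<le> CARD('a ^ 'n)" using Suc.prems by linarith
  from Suc.IH[OF this] obtain K :: "('a ^ 'n) set" where
    *: "0 \<in> K \<and> (\<forall>x\<in>K. \<forall>y\<in>K. x + y \<in> K) \<and> card K = p ^ N \<and>
      (\<forall>(f :: 'a ^ 'n \<Rightarrow> 'a) d. deg_le d f \<longrightarrow> d < N * (p - 1) \<longrightarrow> sum f K = 0)" ..
  then have K: "0 \<in> K" "\<And>x y. x \<in> K \<Longrightarrow> y \<in> K \<Longrightarrow> x + y \<in> K" "card K = p ^ N"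
    by blast+
  have K0: "sum f K = 0" if "deg_le d f" "d < N * (p - 1)" for f :: "'a ^ 'n \<Rightarrow> 'a" and d
    using * that by blast
  have "K \<noteq> UNIV" using K(3) less Suc.prems by (metis leD)
  then obtain e where e: "e \<notin> K" by auto
  define g where "g = (\<lambda>(y, t). y + of_nat t *s e)"
  note ext = subgroup_extend[OF p K(1,2) e, folded g_def]
  have "sum f (g ` (K \<times> {..<p})) = 0" if f: "deg_le d f" "d < Suc N * (p - 1)"
    for f :: "'a ^ 'n \<Rightarrow> 'a" and d
  proof -
    have "sum f (g ` (K \<times> {..<p})) = sum (f \<circ> g) (K \<times> {..<p})"
      by (rule sum.reindex[OF ext(1)])
    also have "\<dots> = (\<Sum>(y, t)\<in>K \<times> {..<p}. f (y + of_nat t *s e))"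
      by (rule sum.cong) (auto simp: g_def)
    also have "\<dots> = (\<Sum>y\<in>K. \<Sum>t<p. f (y + of_nat t *s e))"
      by (rule sum.cartesian_product[symmetric])
    also have "\<dots> = sum ((diff e ^^ (p - 1)) f) K"
      by (simp add: sum_line[OF p])
    also have "\<dots> = 0"
    \<comment> \<open>For \<open>d < p - 1\<close> the subtraction \<open>d - (p - 1)\<close> would
      be truncated, but then the iterated difference is already zero.\<close>
    proof (cases "p - 1 \<le> d")
      case True
      with f show ?thesis by (intro K0[OF deg_le_funpow_diff]) auto
    next
      case False
      with f show ?thesis by (simp add: funpow_diff_eq_0)
    qed
    finally show ?thesis .
  qed
  moreover have "card (g ` (K \<times> {..<p})) = p ^ Suc N"
    by (simp add: card_image[OF ext(1)] card_cartesian_product K)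
  ultimately show ?case using ext(2,3) by (intro exI[of _ "g ` (K \<times> {..<p})"]) blast
qed

lemma sum_deg_le_eq_0:
  fixes f :: "'a::{field,finite} ^ 'n \<Rightarrow> 'a"
  assumes "prime p" "CHAR('a) = p" "CARD('a ^ 'n) = p ^ N" "deg_le d f" "d < N * (p - 1)"
  shows "sum f UNIV = 0"
proof -
  obtain K :: "('a ^ 'n) set" where "card K = p ^ N" "sum f K = 0"
    using exists_subgroup_sum_deg_le_eq_0[OF assms(1,2), of N] assms(3-5)
    by (metis order_refl)
  moreover from this have "K = UNIV" using assms(3) by (metis card_subset_eq finite top_greatest)
  ultimately show ?thesis by simp
qed

section \<open>Products of additive maps and the effect of a matrix factor\<close>

lemma additive_power_CHAR_power:
  fixes f :: "'g::ab_group_add \<Rightarrow> 'a::field"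
  assumes "prime CHAR('a)" "Modules.additive f"
  shows "Modules.additive (\<lambda>x. f x ^ CHAR('a) ^ j)"
  using assms by (auto simp: Modules.additive_def freshmans_dream')

lemma additive_row_power:
  fixes M :: "'a::field ^ 'n ^ 'm"
  assumes "prime CHAR('a)"
  shows "Modules.additive (\<lambda>x. (M *v x) $ i ^ CHAR('a) ^ j)"
  by (rule additive_power_CHAR_power[OF assms])
    (simp add: Modules.additive_def matrix_vector_right_distrib)

text \<open>The list \<open>es\<close> holds the linear forms still to be expanded, and
  \<open>m\<close> the exponents of the monomial obtained so far. The constant \<open>c\<close> is
  chosen before \<open>a\<close>, so it can later be shared by all matrices
  \<open>A\<close>.\<close>

lemma sum_product_forms:
  fixes F :: "'a::{field,finite} ^ 'n \<Rightarrow> 'a" and es :: "('m::finite \<Rightarrow> 'a) list"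
  assumes p: "prime p" "CHAR('a) = p" "CARD('a ^ 'n) = p ^ N"
    and F: "deg_le D F" "D + CARD('m) * (p - 1) \<le> N * (p - 1)"
    and "length es + (\<Sum>l\<in>UNIV. m l) = CARD('m) * (p - 1)"
  shows "\<exists>c. \<forall>a. (\<forall>l. Modules.additive (a l)) \<longrightarrow>
    (\<Sum>x\<in>UNIV. F x * ((\<Prod>e\<leftarrow>es. \<Sum>l\<in>UNIV. e l * a l x) * (\<Prod>l\<in>UNIV. a l x ^ m l))) =
    c * (\<Sum>x\<in>UNIV. F x * (\<Prod>l\<in>UNIV. a l x ^ (p - 1)))"
  using assms(6)
proof (induction es arbitrary: m)
  case Nil
  show ?case
  proof (cases "\<forall>l. m l = p - 1")
    case True
    then show ?thesis by (intro exI[of _ 1]) simp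
  next
    case False
    \<comment> \<open>The exponents average \<open>p - 1\<close> and are not all equal to it, so one
      of them is larger.\<close>
    have "\<exists>l. m l \<ge> p"
    proof (rule ccontr)
      assume "\<not> (\<exists>l. m l \<ge> p)"
      then have le: "\<forall>l. m l \<le> p - 1" by (metis Suc_pred' less_Suc_eq_le linorder_not_le p(1) prime_gt_0_nat)
      with False have "(\<Sum>l\<in>UNIV. m l) < (\<Sum>l\<in>(UNIV::'m set). p - 1)"
        by (intro sum_strict_mono_ex1) (auto simp: order.order_iff_strict)
      with Nil show False by simp
    qed
    then obtain l where l: "m l \<ge> p" ..
    have "(\<Sum>x\<in>UNIV. F x * (\<Prod>l\<in>UNIV. a l x ^ m l)) = 0" if a: "\<forall>l. Modules.additive (a l)" for a
    proof -
      \<comment> \<open>Since \<open>a l x ^ p\<close> is additive it has degree 1 instead of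
        \<open>p\<close>, which saves at least one degree in the factor \<open>l\<close>.\<close>
      let ?d = "\<lambda>i. if i = l then m l - 1 else m i"
      have "deg_le (?d i) (\<lambda>x. a i x ^ m i)" for i
      proof (cases "i = l")
        case True
        have "Modules.additive (\<lambda>x. a l x ^ p)"
          using additive_power_CHAR_power[of "a l" 1] a p by simp
        then have "deg_le (1 + (m l - p) * 1) (\<lambda>x. a l x ^ p * a l x ^ (m l - p))"
          using a by (intro deg_le_mult deg_le_power deg_le_additive) auto
        moreover have "1 + (m l - p) * 1 \<le> m l - 1"
          using l prime_ge_2_nat[OF p(1)] by simp
        ultimately have "deg_le (m l - 1) (\<lambda>x. a l x ^ p * a l x ^ (m l - p))"
          by (rule deg_le_mono)
        then show ?thesis using True l by (simp flip: power_add)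
      next
        case False
        then show ?thesis using deg_le_power[OF deg_le_additive, of "a i" "m i"] a by simp
      qed
      then have "deg_le (D + sum ?d UNIV) (\<lambda>x. F x * (\<Prod>l\<in>UNIV. a l x ^ m l))"
        by (intro deg_le_mult F deg_le_prod)
      moreover have "sum ?d UNIV < sum m UNIV"
        by (rule sum_strict_mono_ex1) (use l prime_gt_0_nat[OF p(1)] in \<open>auto intro!: exI[of _ l]\<close>)
      then have "D + sum ?d UNIV < N * (p - 1)" using Nil F(2) by simp
      ultimately show ?thesis by (rule sum_deg_le_eq_0[OF p])
    qed
    then show ?thesis by (intro exI[of _ 0]) simp
  qed
next
  case (Cons e es)
  \<comment> \<open>Choosing the term \<open>k\<close> of the form \<open>e\<close> raises the
    exponent of \<open>a k\<close> by one and shortens the list by one, so the total degree is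
    unchanged.\<close>
  let ?m = "\<lambda>k l. m l + (if l = k then 1 else 0)"
  have "\<exists>c. \<forall>a. (\<forall>l. Modules.additive (a l)) \<longrightarrow>
    (\<Sum>x\<in>UNIV. F x * ((\<Prod>e\<leftarrow>es. \<Sum>l\<in>UNIV. e l * a l x) * (\<Prod>l\<in>UNIV. a l x ^ ?m k l))) =
    c * (\<Sum>x\<in>UNIV. F x * (\<Prod>l\<in>UNIV. a l x ^ (p - 1)))" for k
    by (rule Cons.IH) (use Cons.prems in \<open>simp add: sum.distrib\<close>)
  from choice[OF allI, OF this] obtain c where "\<forall>k a. (\<forall>l. Modules.additive (a l)) \<longrightarrow>
    (\<Sum>x\<in>UNIV. F x * ((\<Prod>e\<leftarrow>es. \<Sum>l\<in>UNIV. e l * a l x) * (\<Prod>l\<in>UNIV. a l x ^ ?m k l))) =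
    c k * (\<Sum>x\<in>UNIV. F x * (\<Prod>l\<in>UNIV. a l x ^ (p - 1)))" ..
  note c = this[rule_format]
  have pm: "(\<Prod>l\<in>UNIV. a l x ^ ?m k l) = a k x * (\<Prod>l\<in>UNIV. a l x ^ m l)" for a k and x :: "'a ^ 'n"
  proof -
    have "(\<Prod>l\<in>UNIV. a l x ^ (if l = k then 1 else 0)) = (\<Prod>l\<in>UNIV. if l = k then a l x else 1)"
      by (rule prod.cong) auto
    then show ?thesis by (simp add: power_add prod.distrib mult.commute)
  qed
  have "(\<Sum>x\<in>UNIV. F x * ((\<Prod>e\<leftarrow>e # es. \<Sum>l\<in>UNIV. e l * a l x) * (\<Prod>l\<in>UNIV. a l x ^ m l))) =
    (\<Sum>k\<in>UNIV. e k * c k) * (\<Sum>x\<in>UNIV. F x * (\<Prod>l\<in>UNIV. a l x ^ (p - 1)))"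
    if a: "\<forall>l. Modules.additive (a l)" for a
  proof -
    have "(\<Sum>k\<in>UNIV. e k * c k) * (\<Sum>x\<in>UNIV. F x * (\<Prod>l\<in>UNIV. a l x ^ (p - 1))) =
      (\<Sum>k\<in>UNIV. e k * (\<Sum>x\<in>UNIV. F x * ((\<Prod>e\<leftarrow>es. \<Sum>l\<in>UNIV. e l * a l x) * (\<Prod>l\<in>UNIV. a l x ^ ?m k l))))"
      unfolding c[OF a[rule_format]] sum_distrib_right by (simp add: mult.assoc)
    also have "\<dots> = (\<Sum>x\<in>UNIV. \<Sum>k\<in>UNIV. e k * (F x * ((\<Prod>e\<leftarrow>es. \<Sum>l\<in>UNIV. e l * a l x) * (\<Prod>l\<in>UNIV. a l x ^ ?m k l))))"
      unfolding sum_distrib_left by (rule sum.swap)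
    also have "\<dots> = (\<Sum>x\<in>UNIV. F x * ((\<Prod>e\<leftarrow>e # es. \<Sum>l\<in>UNIV. e l * a l x) * (\<Prod>l\<in>UNIV. a l x ^ m l)))"
      unfolding pm by (simp add: sum_distrib_left sum_distrib_right mult_ac)
    finally show ?thesis by simp
  qed
  then show ?case by blast
qed

lemma sum_twisted_rows_matrix_mult:
  fixes F :: "'a::{field,finite} ^ 'n \<Rightarrow> 'a" and E :: "'a ^ 'n ^ 'n"
  assumes p: "prime p" "CHAR('a) = p" "CARD('a ^ 'n) = p ^ N"
    and F: "deg_le D F" "D + CARD('n) * (p - 1) \<le> N * (p - 1)"
  shows "\<exists>c. \<forall>A :: 'a ^ 'n ^ 'n.
    (\<Sum>x\<in>UNIV. F x * (\<Prod>i\<in>UNIV. (((E ** A) *v x) $ i ^ p ^ j) ^ (p - 1))) =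
    c * (\<Sum>x\<in>UNIV. F x * (\<Prod>i\<in>UNIV. ((A *v x) $ i ^ p ^ j) ^ (p - 1)))"
proof -
  obtain rows :: "'n list" where rows: "set rows = UNIV" "distinct rows"
    using finite_distinct_list[of "UNIV :: 'n set"] by auto
  \<comment> \<open>Each row of \<open>E\<close> occurs \<open>p - 1\<close> times. Its entries are
    raised to \<open>p ^ j\<close> because the Frobenius power of a row of \<open>E ** A\<close> is
    a combination of the powers of the rows of \<open>A\<close> with these coefficients.\<close>
  define es where "es = concat (map (\<lambda>i. replicate (p - 1) (\<lambda>l. E $ i $ l ^ p ^ j)) rows)"
  have "length rows = CARD('n)" using rows distinct_card by metis
  then have "length es = CARD('n) * (p - 1)"
    by (simp add: es_def length_concat o_def sum_list_triv)
  then obtain c where c: "\<And>a. (\<forall>l. Modules.additive (a l)) \<Longrightarrow>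
    (\<Sum>x\<in>UNIV. F x * ((\<Prod>e\<leftarrow>es. \<Sum>l\<in>UNIV. e l * a l x) * (\<Prod>l\<in>UNIV. a l x ^ 0))) =
    c * (\<Sum>x\<in>UNIV. F x * (\<Prod>l\<in>UNIV. a l x ^ (p - 1)))"
    using sum_product_forms[OF p F, of es "\<lambda>_. 0"] by auto
  have prod_es: "(\<Prod>e\<leftarrow>es. h e) = (\<Prod>i\<in>UNIV. h (\<lambda>l. E $ i $ l ^ p ^ j) ^ (p - 1))" for h :: "_ \<Rightarrow> 'a"
  proof -
    have "(\<Prod>e\<leftarrow>es. h e) = (\<Prod>i\<leftarrow>rows. h (\<lambda>l. E $ i $ l ^ p ^ j) ^ (p - 1))"
      unfolding es_def by (induction rows) (simp_all add: prod_list_replicate)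
    then show ?thesis using rows prod.distinct_set_conv_list by metis
  qed
  have row: "((E ** A) *v x) $ i ^ p ^ j = (\<Sum>l\<in>UNIV. E $ i $ l ^ p ^ j * (A *v x) $ l ^ p ^ j)" for A x i
  proof -
    have "((E ** A) *v x) $ i = (\<Sum>l\<in>UNIV. E $ i $ l * (A *v x) $ l)"
      unfolding matrix_vector_mul_assoc[symmetric] by (simp add: matrix_vector_mult_def[of E])
    then show ?thesis
      using p by (simp add: freshmans_dream_sum' power_mult_distrib)
  qed
  have "(\<Sum>x\<in>UNIV. F x * (\<Prod>i\<in>UNIV. (((E ** A) *v x) $ i ^ p ^ j) ^ (p - 1))) =
    c * (\<Sum>x\<in>UNIV. F x * (\<Prod>i\<in>UNIV. ((A *v x) $ i ^ p ^ j) ^ (p - 1)))" for A :: "'a ^ 'n ^ 'n"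
  proof -
    have "\<forall>l. Modules.additive (\<lambda>x. (A *v x) $ l ^ p ^ j)"
      using additive_row_power p by blast
    from c[OF this] show ?thesis by (simp add: prod_es row)
  qed
  then show ?thesis by blast
qed

section \<open>The sum for identity matrices\<close>

lemma geometric_sum_nat: "(p - 1) * (\<Sum>j<k. p ^ j) = p ^ k - (1::nat)" if "p > 0"
proof -
  from that obtain m where "p = Suc m" by (cases p) auto
  moreover have "m * (\<Sum>j<k. Suc m ^ j) + 1 = Suc m ^ k"
    by (induction k) (auto simp: algebra_simps)
  ultimately show ?thesis by (metis add_diff_cancel_right' diff_Suc_1)
qed

lemma sum_twisted_coordinates:
  assumes p: "prime p" and card: "CARD('a::{field,finite}) = p ^ k" and "k > 0"
  shows "(\<Sum>x\<in>(UNIV :: ('a ^ 'n) set). \<Prod>j<k. \<Prod>i\<in>UNIV. (x $ i ^ p ^ j) ^ (p - 1)) = (- 1) ^ CARD('n)"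
proof -
  have q: "p ^ k > 1" using prime_gt_1_nat[OF p] \<open>k > 0\<close> by (rule one_less_power)
  have "(\<Prod>j<k. \<Prod>i\<in>UNIV. (x $ i ^ p ^ j) ^ (p - 1)) = of_bool (\<forall>i. x $ i \<in> -{0})" for x :: "'a ^ 'n"
  proof -
    have "(\<Prod>j<k. \<Prod>i\<in>UNIV. (x $ i ^ p ^ j) ^ (p - 1)) = (\<Prod>i\<in>UNIV. \<Prod>j<k. (x $ i ^ p ^ j) ^ (p - 1))"
      by (rule prod.swap)
    \<comment> \<open>The exponents \<open>p ^ j * (p - 1)\<close> for \<open>j < k\<close> add up
      to \<open>p ^ k - 1\<close>, the order of the multiplicative group.\<close>
    also have "\<dots> = (\<Prod>i\<in>UNIV. x $ i ^ ((p - 1) * (\<Sum>j<k. p ^ j)))"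
      by (simp add: power_sum sum_distrib_left mult.commute flip: power_mult)
    also have "\<dots> = (\<Prod>i\<in>UNIV. x $ i ^ (CARD('a) - 1))"
      using geometric_sum_nat[of p k] prime_gt_0_nat[OF p] by (simp add: card)
    also have "\<dots> = of_bool (\<forall>i. x $ i \<in> -{0})"
    proof (cases "\<forall>i. x $ i \<in> -{0}")
      case True
      then have "x $ i ^ (CARD('a) - 1) = 1" for i by (intro field_power_card_minus_1) simp
      with True show ?thesis by simp
    next
      case False
      then show ?thesis using q by (auto simp: card power_0_left)
    qed
    finally show ?thesis .
  qed
  then have "(\<Sum>x\<in>(UNIV :: ('a ^ 'n) set). \<Prod>j<k. \<Prod>i\<in>UNIV. (x $ i ^ p ^ j) ^ (p - 1)) =
      of_nat (card {x :: 'a ^ 'n. \<forall>i. x $ i \<in> -{0}})"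
    by (simp add: of_bool_def sum.If_cases)
  also have "\<dots> = of_nat (p ^ k - 1) ^ CARD('n)"
    unfolding card_vec_range by (simp add: Compl_eq_Diff_UNIV card)
  also have "of_nat (p ^ k - 1) = (- 1 :: 'a)"
    using q of_nat_CHAR[where ?'a = 'a] CHAR_finite_field[OF p card] \<open>k > 0\<close>
    by (simp add: of_nat_diff power_0_left)
  finally show ?thesis .
qed

section \<open>From identities to arbitrary invertible matrices\<close>

text \<open>The identities are exchanged for the \<open>B j\<close> one at a time, \<open>m\<close>
  counting those exchanged. The sum before an exchange is a constant times the sum after it, so the
  latter is nonzero too.\<close>

lemma sum_twisted_rows_nonzero:
  fixes B :: "nat \<Rightarrow> 'a::{field,finite} ^ 'n ^ 'n"
  assumes p: "prime p" and card: "CARD('a) = p ^ k"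
    and B: "\<And>j. j < k \<Longrightarrow> invertible (B j)" and "m \<le> k" "k > 0"
  shows "(\<Sum>x\<in>UNIV. \<Prod>j<k. \<Prod>i\<in>UNIV. (((if j < m then B j else mat 1) *v x) $ i ^ p ^ j) ^ (p - 1)) \<noteq> 0"
  using \<open>m \<le> k\<close>
proof (induction m)
  case 0
  have "(\<Sum>x\<in>(UNIV :: ('a ^ 'n) set). \<Prod>j<k. \<Prod>i\<in>UNIV. (x $ i ^ p ^ j) ^ (p - 1)) \<noteq> 0"
    by (simp only: sum_twisted_coordinates[OF p card \<open>k > 0\<close>]) simp
  then show ?case by simp
next
  case (Suc m)
  note char = CHAR_finite_field[OF p card]
  obtain B' where inv: "B' ** B m = mat 1"
    using B[of m] Suc.prems by (auto simp: invertible_def)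
  let ?G = "\<lambda>M j x. \<Prod>i\<in>UNIV. ((M *v x) $ i ^ p ^ j) ^ (p - 1)"
  define F where "F = (\<lambda>x. \<Prod>j\<in>{..<k} - {m}. ?G (if j < m then B j else mat 1) j x)"
  have split: "(\<Prod>j<k. h j) = (\<Prod>j\<in>{..<k} - {m}. h j) * h m" for h :: "nat \<Rightarrow> 'a"
    using Suc.prems prod.remove[of "{..<k}" m h] by (simp add: mult.commute)
  have add: "Modules.additive (\<lambda>x. (M *v x) $ i ^ p ^ j)" for M :: "'a ^ 'n ^ 'n" and i j
    using additive_row_power p char by blast
  have "deg_le (\<Sum>j\<in>{..<k} - {m}. \<Sum>i\<in>(UNIV::'n set). (p - 1) * 1) F"
    unfolding F_def by (intro deg_le_prod deg_le_power deg_le_additive add)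
  then have F: "deg_le ((k - 1) * (CARD('n) * (p - 1))) F"
    using Suc.prems by simp
  \<comment> \<open>The other \<open>k - 1\<close> indices leave exactly the degree that the rows of
    index \<open>m\<close> contribute.\<close>
  have "(k - 1) * (CARD('n) * (p - 1)) + CARD('n) * (p - 1) \<le> k * CARD('n) * (p - 1)"
    using \<open>k > 0\<close> by (cases k) (auto simp: algebra_simps)
  moreover have "CARD('a ^ 'n) = p ^ (k * CARD('n))" by (simp add: card power_mult)
  ultimately obtain c where c: "\<And>A. (\<Sum>x\<in>UNIV. F x * ?G (B' ** A) m x) = c * (\<Sum>x\<in>UNIV. F x * ?G A m x)"
    using sum_twisted_rows_matrix_mult[OF p char _ F, of _ "B'" m] by blast
  have "(\<Sum>x\<in>UNIV. F x * ?G (mat 1) m x) = c * (\<Sum>x\<in>UNIV. F x * ?G (B m) m x)"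
    using c[of "B m"] by (simp add: inv)
  moreover have "(\<Sum>x\<in>UNIV. F x * ?G (mat 1) m x) \<noteq> 0"
    using Suc unfolding F_def split by simp
  moreover have "F x = (\<Prod>j\<in>{..<k} - {m}. ?G (if j < Suc m then B j else mat 1) j x)" for x
    unfolding F_def by (rule prod.cong) (auto simp: less_Suc_eq)
  ultimately show ?case unfolding split by auto
qed

theorem theorem1p1:
  fixes A :: "nat \<Rightarrow> 'a::{field,finite} ^ 'n ^ 'n"
    and p k r :: nat
  assumes "prime p"
    and "CARD('a) = p ^ k"
    and "r \<ge> 2"
    and "\<forall>i\<in>{1..r - 1}. invertible (A i)"
    and "k \<ge> r"
  shows "\<exists>x :: 'a ^ 'n. nowhere_zero x \<and> (\<forall>i\<in>{1..r - 1}. nowhere_zero (A i *v x))"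
proof -
  \<comment> \<open>Index 0 gets the identity, which accounts for \<open>x\<close> itself;
    \<open>r \<le> k\<close> leaves room for all the \<open>A i\<close>.\<close>
  define B where "B j = (if j \<in> {1..r - 1} then A j else mat 1)" for j
  have "k > 0" using assms by simp
  have "invertible (mat 1 :: 'a ^ 'n ^ 'n)" unfolding invertible_def by (intro exI[of _ "mat 1"]) simp
  then have "invertible (B j)" for j using assms(4) by (simp add: B_def)
  then have "(\<Sum>x\<in>UNIV. \<Prod>j<k. \<Prod>i\<in>UNIV.
      (((if j < k then B j else mat 1) *v x) $ i ^ p ^ j) ^ (p - 1)) \<noteq> 0"
    by (intro sum_twisted_rows_nonzero assms(1,2) order_refl \<open>k > 0\<close>)
  then obtain x where x: "(\<Prod>j<k. \<Prod>i\<in>UNIV.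
      (((if j < k then B j else mat 1) *v x) $ i ^ p ^ j) ^ (p - 1)) \<noteq> 0"
    by (meson sum.neutral)
  have "nowhere_zero (B j *v x)" if "j < k" for j
  proof -
    \<comment> \<open>With positive exponents a zero coordinate would make the whole product
      zero.\<close>
    have "p - 1 > 0" "p ^ j > 0" using prime_gt_1_nat[OF assms(1)] by auto
    with x that show ?thesis by (auto simp: nowhere_zero_def)
  qed
  note nz = this
  have "nowhere_zero x" using nz[of 0] \<open>k > 0\<close> by (simp add: B_def)
  moreover have "nowhere_zero (A i *v x)" if "i \<in> {1..r - 1}" for i
  proof -
    have "i < k" using that assms(3,5) by auto
    with nz[of i] that show ?thesis by (simp add: B_def)
  qed
  ultimately show ?thesis by blast
qed

end
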